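(* Let $X$ and $\Lambda$ be (nonempty) compact metric spaces and let $w:\Lambda\times X\to X$ be a weakly hyperbolic iterated function system. Then there is a set $K\in\mathcal K(X)$ which is a global attractor of $w$, that is, $\mathcal F^n(B)\to K$ in the Hausdorff metric for every $B\in\mathcal K(X)$, and which is also invariant, that is, $\mathcal F(K)=K$. Furthermore, for every $\sigma\in\Omega$ and every $n\ge 1$ the map $w_{\sigma_1}\circ\cdots\circ w_{\sigma_n}$ has a unique fixed point in $X$, and $K$ is the closure of the set of all these fixed points (over all $\sigma\in\Omega$ and $n\geq 1$).
   Context: An iterated function system (IFS) is a continuous map $w:\Lambda\times X\to X$, where $\Lambda$ is a compact metric space (parameter space) and $X$ is a complete metric space (phase space). For $\lambda\in\Lambda$ put $w_\lambda(x):=w(\lambda,x)$, and put $w_{\lambda_1\dots\lambda_n}:=w_{\lambda_1}\circ\cdots\circ w_{\lambda_n}$. $\Omega:=\Lambda^{\mathbb N}$ denotes the space of infinite words $\sigma=(\sigma_1,\sigma_2,\dots)$. When $X$ is compact, $w$ is weakly hyperbolic if for every $\sigma\in\Omega$, $\lim_{n\to\infty}\mathrm{Diam}(w_{\sigma_1\dots\sigma_n}(X))=0$. $\mathcal K(X)$ is the family of all nonempty compact subsets of $X$ with the Hausdorff metric $d_H(A,B)=\sup\{d(a,B),d(b,A):a\in A,b\in B\}$, where $d(x,F)=\inf\{d(x,y):y\in F\}$. The Hutchinson-Barnsley operator $\mathcal F:\mathcal K(X)\to\mathcal K(X)$ is $\mathcal F(A)=\bigcup_{\lambda\in\Lambda}w_\lambda(A)=w(\Lambda\times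 A)$. *)

theory Defs
  imports "HOL-Analysis.Analysis"
begin

text \<open>
  Metric spaces are rendered as subsets \<open>\<Lambda>\<close> (parameters) and \<open>X\<close> (phases) of metric-space types,
  carrying the restricted metric; an abstract metric space is the case where the subset is the
  whole type. Maps are total functions that only matter on these carriers.
\<close>

definition iterated_function_system ::
    "'l::metric_space set \<Rightarrow> 'a::metric_space set \<Rightarrow> ('l \<times> 'a \<Rightarrow> 'a) \<Rightarrow> bool" where
  "iterated_function_system \<Lambda> X w \<longleftrightarrow>
     compact \<Lambda> \<and> complete X \<and> continuous_on (\<Lambda> \<times> X) w \<and> w \<in> \<Lambda> \<times> X \<rightarrow> X"

text \<open>Words are indexed from 0, so the letters usually written \<open>\<sigma>\<^sub>1, \<sigma>\<^sub>2, \<dots>\<close> are \<open>\<sigma> 0, \<sigma> 1, \<dots>\<close>.\<close>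

definition infinite_words :: "'l set \<Rightarrow> (nat \<Rightarrow> 'l) set" where
  "infinite_words \<Lambda> = {\<sigma>. \<forall>i. \<sigma> i \<in> \<Lambda>}"

text \<open>\<open>word_map w \<sigma> n\<close> composes the maps of the first \<open>n\<close> letters, with that of \<open>\<sigma> 0\<close> outermost.\<close>

primrec word_map :: "('l \<times> 'a \<Rightarrow> 'a) \<Rightarrow> (nat \<Rightarrow> 'l) \<Rightarrow> nat \<Rightarrow> 'a \<Rightarrow> 'a" where
  "word_map w \<sigma> 0 = id"
| "word_map w \<sigma> (Suc n) = word_map w \<sigma> n \<circ> (\<lambda>x. w (\<sigma> n, x))"

definition weakly_hyperbolic ::
    "'l set \<Rightarrow> 'a::metric_space set \<Rightarrow> ('l \<times> 'a \<Rightarrow> 'a) \<Rightarrow> bool" where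
  "weakly_hyperbolic \<Lambda> X w \<longleftrightarrow>
     (\<forall>\<sigma>\<in>infinite_words \<Lambda>. (\<lambda>n. diameter (word_map w \<sigma> n ` X)) \<longlonglongrightarrow> 0)"

definition nonempty_compacts :: "'a::metric_space set \<Rightarrow> 'a set set" where
  "nonempty_compacts X = {A. A \<subseteq> X \<and> compact A \<and> A \<noteq> {}}"

text \<open>The supremum is taken in the reals, hence is meaningful only for nonempty bounded arguments.\<close>

definition hausdorff_dist :: "'a::metric_space set \<Rightarrow> 'a set \<Rightarrow> real" where
  "hausdorff_dist A B = Sup ((\<lambda>a. infdist a B) ` A \<union> (\<lambda>b. infdist b A) ` B)"

definition hutchinson :: "'l set \<Rightarrow> ('l \<times> 'a \<Rightarrow> 'a) \<Rightarrow> 'a set \<Rightarrow> 'a set" where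
  "hutchinson \<Lambda> w A = (\<Union>l\<in>\<Lambda>. (\<lambda>x. w (l, x)) ` A)"

lemma hutchinson_eq_image: "hutchinson \<Lambda> w A = w ` (\<Lambda> \<times> A)"
  unfolding hutchinson_def by auto

lemma hutchinson_in_nonempty_compacts:
  assumes "iterated_function_system \<Lambda> X w" "\<Lambda> \<noteq> {}" "A \<in> nonempty_compacts X"
  shows "hutchinson \<Lambda> w A \<in> nonempty_compacts X"
proof -
  have A: "A \<subseteq> X" "compact A" "A \<noteq> {}"
    using assms(3) by (auto simp: nonempty_compacts_def)
  have w: "compact \<Lambda>" "continuous_on (\<Lambda> \<times> X) w" "w \<in> \<Lambda> \<times> X \<rightarrow> X"
    using assms(1) by (auto simp: iterated_function_system_def)
  have "continuous_on (\<Lambda> \<times> A) w"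
    by (rule continuous_on_subset[OF w(2)]) (use A in auto)
  then have "compact (w ` (\<Lambda> \<times> A))"
    using w(1) A(2) by (intro compact_continuous_image compact_Times)
  moreover have "w ` (\<Lambda> \<times> A) \<subseteq> X"
    using w(3) A(1) by blast
  ultimately show ?thesis
    using assms(2) A(3) by (simp add: nonempty_compacts_def hutchinson_eq_image)
qed

definition global_attractor ::
    "'l set \<Rightarrow> 'a::metric_space set \<Rightarrow> ('l \<times> 'a \<Rightarrow> 'a) \<Rightarrow> 'a set \<Rightarrow> bool" where
  "global_attractor \<Lambda> X w K \<longleftrightarrow>
     K \<in> nonempty_compacts X \<and>
     (\<forall>B\<in>nonempty_compacts X. (\<lambda>n. hausdorff_dist ((hutchinson \<Lambda> w ^^ n) B) K) \<longlonglongrightarrow> 0)"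

end

theory Submission
  imports Defs
begin

text \<open>
  Call \<open>w\<^bsub>\<sigma>\<^sub>1\<dots>\<sigma>\<^sub>n\<^esub>(X)\<close> the cylinder of level \<open>n\<close> along \<open>\<sigma>\<close>. Cylinders along one word are nested
  compact sets, so the words that have a cylinder of diameter at least \<open>e\<close> at level \<open>n\<close> form a
  decreasing sequence of sets, each of them compact in the product topology. If all of these were
  nonempty, a common word would contradict weak hyperbolicity. Hence the diameters tend to zero
  uniformly over all words (\<open>uniformly_small_cylinders\<close>), and everything else follows by repeating
  and shifting words.

  Repeating the first \<open>n\<close> letters of \<open>\<sigma>\<close> periodically gives a word whose cylinder of level \<open>k n\<close> is
  \<open>f\<^sup>k(X)\<close> with \<open>f = w\<^bsub>\<sigma>\<^sub>1\<dots>\<sigma>\<^sub>n\<^esub>\<close>. The intersection of these sets is a single point, which is then the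
  unique fixed point of \<open>f\<close> (\<open>ex1_fixed_point\<close>).

  Let \<open>P\<close> be the set of all such fixed points and \<open>K\<close> its closure. Every cylinder of level at least
  one contains a point of \<open>P\<close>, namely the fixed point of its own composition; and every point of
  \<open>P\<close> lies in cylinders of all levels along a single word. Since \<open>\<F>\<^sup>n(B)\<close> is contained in the union
  of the cylinders of level \<open>n\<close> and meets each of them, uniform smallness puts \<open>\<F>\<^sup>n(B)\<close> and \<open>P\<close>
  within Hausdorff distance \<open>e\<close> for all large \<open>n\<close>, whatever \<open>B\<close> is.

  For invariance, applying \<open>w\<^sub>\<lambda>\<close> to a point of \<open>P\<close> prepends the letter \<open>\<lambda>\<close> to its word, and a point
  that lies in all cylinders along some word belongs to \<open>K\<close>
  (\<open>in_closure_if_in_all_cylinders\<close>). Conversely, a point of \<open>P\<close> is the image under \<open>w\<^bsub>\<sigma>\<^sub>1\<^esub>\<close> of the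
  fixed point that belongs to the cyclically rotated word (\<open>fixed_point_rotate\<close>).
\<close>

section \<open>Nested compact sets\<close>

lemma compact_nested_Inter_nonempty:
  fixes F :: "nat \<Rightarrow> 'b::t2_space set"
  assumes compact: "\<And>n. compact (F n)" and nonempty: "\<And>n. F n \<noteq> {}"
    and antimono: "\<And>m n. m \<le> n \<Longrightarrow> F n \<subseteq> F m"
  shows "\<Inter> (range F) \<noteq> {}"
proof -
  have "F 0 \<inter> \<Inter> (F ` I) \<noteq> {}" if "finite I" for I
  proof -
    have sub: "F (Max (insert 0 I)) \<subseteq> F i" if "i \<in> insert 0 I" for i
      by (rule antimono, rule Max_ge) (use \<open>finite I\<close> that in auto)
    obtain x where "x \<in> F (Max (insert 0 I))"
      using nonempty[of "Max (insert 0 I)"] by (meson ex_in_conv)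
    then have "x \<in> F i" if "i \<in> insert 0 I" for i
      using sub[OF that] by (rule subsetD[rotated])
    then have "x \<in> F 0 \<inter> \<Inter> (F ` I)" by simp
    then show ?thesis by (metis emptyE)
  qed
  then have "F 0 \<inter> \<Inter> (F ` UNIV) \<noteq> {}"
    by (rule compact_imp_fip_image[OF compact compact_imp_closed[OF compact]])
  then show ?thesis by blast
qed

section \<open>Words and compositions\<close>

lemma word_map_cong:
  assumes "\<And>i. i < n \<Longrightarrow> \<sigma> i = \<tau> i"
  shows "word_map w \<sigma> n = word_map w \<tau> n"
  using assms by (induction n) auto

lemma word_map_add:
  "word_map w \<sigma> (m + n) = word_map w \<sigma> m \<circ> word_map w (\<lambda>i. \<sigma> (m + i)) n"
  by (induction n) (auto simp: fun_eq_iff)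

lemma word_map_Suc_left:
  "word_map w \<sigma> (Suc n) x = w (\<sigma> 0, word_map w (\<lambda>i. \<sigma> (Suc i)) n x)"
  using word_map_add[of w \<sigma> 1 n] by simp

text \<open>The periodic word that repeats the first \<open>n\<close> letters of \<open>\<sigma>\<close>. For \<open>n = 0\<close> it is \<open>\<sigma>\<close> itself.\<close>

definition loop :: "(nat \<Rightarrow> 'l) \<Rightarrow> nat \<Rightarrow> nat \<Rightarrow> 'l" where
  "loop \<sigma> n i = \<sigma> (i mod n)"

lemma loop_in_infinite_words: "\<sigma> \<in> infinite_words \<Lambda> \<Longrightarrow> loop \<sigma> n \<in> infinite_words \<Lambda>"
  by (simp add: infinite_words_def loop_def)

lemma word_map_loop: "word_map w (loop \<sigma> n) n = word_map w \<sigma> n"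
  by (rule word_map_cong) (simp add: loop_def)

lemma word_map_loop_power: "word_map w (loop \<sigma> n) (k * n) = word_map w \<sigma> n ^^ k"
proof (induction k)
  case (Suc k)
  have "(\<lambda>i. loop \<sigma> n (n + i)) = loop \<sigma> n"
    by (simp add: fun_eq_iff loop_def)
  then show ?case
    using Suc word_map_add[of w "loop \<sigma> n" n "k * n"] by (simp add: word_map_loop)
qed simp

text \<open>With \<open>f\<close> for the first letter and \<open>g\<close> for the composition of the remaining ones, a fixed
  point \<open>x\<close> of \<open>f \<circ> g\<close> gives the fixed point \<open>g x\<close> of \<open>g \<circ> f\<close>, and \<open>g \<circ> f\<close> belongs to the rotated word.
  The formula for \<open>y\<close> serves to locate \<open>y\<close> in the phase space.\<close>

lemma fixed_point_rotate:
  assumes "word_map w \<sigma> n x = x" and "n \<ge> 1"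
  obtains y where "w (\<sigma> 0, y) = x" and "word_map w (\<lambda>i. loop \<sigma> n (Suc i)) n y = y"
    and "y = word_map w (\<lambda>i. loop \<sigma> n (Suc i)) (n - 1) x"
proof -
  define y where "y = word_map w (\<lambda>i. loop \<sigma> n (Suc i)) (n - 1) x"
  obtain m where n: "n = Suc m"
    using assms(2) by (cases n) auto
  have "w (\<sigma> 0, y) = word_map w (loop \<sigma> n) n x"
    unfolding y_def n word_map_Suc_left by (simp add: loop_def)
  then have y: "w (\<sigma> 0, y) = x"
    using assms(1) by (simp add: word_map_loop)
  moreover have "loop \<sigma> n (Suc m) = \<sigma> 0"
    by (simp add: loop_def n)
  ultimately have "word_map w (\<lambda>i. loop \<sigma> n (Suc i)) n y = y"
    by (simp add: n y_def)
  with y y_def that show thesis by blast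
qed

section \<open>The Hausdorff distance\<close>

lemma hausdorff_dist_le:
  assumes "A \<noteq> {}"
    and "\<And>a. a \<in> A \<Longrightarrow> infdist a B \<le> e" and "\<And>b. b \<in> B \<Longrightarrow> infdist b A \<le> e"
  shows "hausdorff_dist A B \<le> e"
  unfolding hausdorff_dist_def by (rule cSup_least) (use assms in auto)

text \<open>The bound \<open>e\<close> makes the supremum meaningful: the supremum of an unbounded set of reals is
  unspecified, so that its sign would be unknown.\<close>

lemma hausdorff_dist_nonneg:
  assumes "A \<noteq> {}"
    and "\<And>a. a \<in> A \<Longrightarrow> infdist a B \<le> e" and "\<And>b. b \<in> B \<Longrightarrow> infdist b A \<le> e"
  shows "0 \<le> hausdorff_dist A B"
proof -
  obtain a where "a \<in> A" using assms(1) by blast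
  moreover have "bdd_above ((\<lambda>a. infdist a B) ` A \<union> (\<lambda>b. infdist b A) ` B)"
    using assms by (intro bdd_aboveI[of _ e]) auto
  ultimately show ?thesis
    unfolding hausdorff_dist_def by (intro cSup_upper2[of "infdist a B"]) (auto simp: infdist_nonneg)
qed

section \<open>Weakly hyperbolic systems on compact spaces\<close>

locale compact_weakly_hyperbolic_ifs =
  fixes \<Lambda> :: "'l::metric_space set" and X :: "'a::metric_space set" and w :: "'l \<times> 'a \<Rightarrow> 'a"
  assumes compact_X: "compact X" and X_nonempty: "X \<noteq> {}"
    and compact_\<Lambda>: "compact \<Lambda>" and \<Lambda>_nonempty: "\<Lambda> \<noteq> {}"
    and ifs: "iterated_function_system \<Lambda> X w"
    and weakly_hyperbolic: "weakly_hyperbolic \<Lambda> X w"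
begin

abbreviation \<Omega> :: "(nat \<Rightarrow> 'l) set" where
  "\<Omega> \<equiv> infinite_words \<Lambda>"

lemma w_in: "l \<in> \<Lambda> \<Longrightarrow> x \<in> X \<Longrightarrow> w (l, x) \<in> X"
  using ifs by (auto simp: iterated_function_system_def)

lemma continuous_w: "continuous_on (\<Lambda> \<times> X) w"
  using ifs by (simp add: iterated_function_system_def)

lemma word_map_in: "\<sigma> \<in> \<Omega> \<Longrightarrow> x \<in> X \<Longrightarrow> word_map w \<sigma> n x \<in> X"
  by (induction n arbitrary: x) (auto simp: w_in infinite_words_def)

lemma cylinder_antimono:
  assumes "\<sigma> \<in> \<Omega>" and "m \<le> n"
  shows "word_map w \<sigma> n ` X \<subseteq> word_map w \<sigma> m ` X"
proof -
  obtain k where n: "n = m + k" using assms(2) le_Suc_ex by blast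
  have "(\<lambda>i. \<sigma> (m + i)) \<in> \<Omega>" using assms(1) by (simp add: infinite_words_def)
  then show ?thesis
    unfolding n word_map_add by (auto intro: word_map_in)
qed

text \<open>Tychonoff's theorem. The topology on words is that of coordinatewise convergence.\<close>

lemma compact_words: "compact \<Omega>"
proof -
  have "\<Omega> = PiE UNIV (\<lambda>_. \<Lambda>)"
    by (auto simp: infinite_words_def PiE_def Pi_def)
  moreover have "compactin (product_topology (\<lambda>_. euclidean) UNIV) (PiE UNIV (\<lambda>_::nat. \<Lambda>))"
    using compact_\<Lambda> by (subst compactin_PiE) auto
  ultimately show ?thesis
    by (simp add: euclidean_product_topology)
qed

text \<open>Joint continuity in word and point is what turns the pointwise hypothesis on diameters into a
  uniform one.\<close>

lemma continuous_word_map: "continuous_on (\<Omega> \<times> X) (\<lambda>(\<sigma>, x). word_map w \<sigma> n x)"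
proof (induction n)
  case 0
  show ?case by (auto intro!: continuous_intros simp: case_prod_unfold)
next
  case (Suc n)
  let ?g = "\<lambda>(\<sigma>, x). (\<sigma>, w (\<sigma> n, x))"
  have letter: "continuous_on (\<Omega> \<times> X) (\<lambda>p. (fst p n, snd p))"
    by (intro continuous_intros continuous_on_product_then_coordinatewise)
  have "continuous_on (\<Omega> \<times> X) (\<lambda>p. w (fst p n, snd p))"
    by (rule continuous_on_compose2[OF continuous_w letter]) (auto simp: infinite_words_def)
  then have "continuous_on (\<Omega> \<times> X) ?g"
    unfolding case_prod_unfold by (intro continuous_on_Pair continuous_on_fst continuous_on_id)
  moreover have "?g ` (\<Omega> \<times> X) \<subseteq> \<Omega> \<times> X"
    by (auto intro: w_in simp: infinite_words_def)
  ultimately have "continuous_on (\<Omega> \<times> X) (\<lambda>p. (\<lambda>(\<sigma>, x). word_map w \<sigma> n x) (?g p))"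
    by (rule continuous_on_compose2[OF Suc])
  then show ?case
    by (simp add: case_prod_unfold)
qed

lemma continuous_word_map_fixed:
  assumes "\<sigma> \<in> \<Omega>"
  shows "continuous_on X (word_map w \<sigma> n)"
proof -
  have "continuous_on X (\<lambda>x. (\<lambda>(\<sigma>, x). word_map w \<sigma> n x) (\<sigma>, x))"
    by (rule continuous_on_compose2[OF continuous_word_map])
      (use assms in \<open>auto intro!: continuous_intros\<close>)
  then show ?thesis by simp
qed

lemma compact_cylinder: "\<sigma> \<in> \<Omega> \<Longrightarrow> compact (word_map w \<sigma> n ` X)"
  using compact_continuous_image[OF continuous_word_map_fixed compact_X] .

lemma dist_le_diameter_cylinder:
  assumes "\<sigma> \<in> \<Omega>" "x \<in> word_map w \<sigma> n ` X" "y \<in> word_map w \<sigma> n ` X"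
  shows "dist x y \<le> diameter (word_map w \<sigma> n ` X)"
  using diameter_bounded_bound[OF compact_imp_bounded[OF compact_cylinder]] assms by blast

lemma eq_if_in_all_cylinders:
  assumes "\<sigma> \<in> \<Omega>" and "\<And>n. x \<in> word_map w \<sigma> n ` X" and "\<And>n. y \<in> word_map w \<sigma> n ` X"
  shows "x = y"
proof -
  have "(\<lambda>n. diameter (word_map w \<sigma> n ` X)) \<longlonglongrightarrow> 0"
    using weakly_hyperbolic assms(1) by (simp add: weakly_hyperbolic_def)
  moreover have "\<forall>n. dist x y \<le> diameter (word_map w \<sigma> n ` X)"
    using dist_le_diameter_cylinder assms by blast
  ultimately have "dist x y \<le> 0"
    by (intro LIMSEQ_le_const) auto
  then show ?thesis by simp
qed

text \<open>This is Dini's theorem for the decreasing sequence of functions sending a word to the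
  diameter of its cylinder of level \<open>n\<close>. The set \<open>W n\<close> of words with a wide cylinder is compact
  because it is the projection of a closed subset of a compact space of triples \<open>(\<sigma>, x, y)\<close>.\<close>

lemma uniformly_small_cylinders:
  assumes "e > 0"
  obtains N where "\<And>n \<sigma> x y. \<lbrakk>n \<ge> N; \<sigma> \<in> \<Omega>; x \<in> word_map w \<sigma> n ` X; y \<in> word_map w \<sigma> n ` X\<rbrakk>
    \<Longrightarrow> dist x y < e"
proof (rule ccontr)
  assume "\<not> thesis"
  with that have wide: "\<exists>n\<ge>N. \<exists>\<sigma>\<in>\<Omega>. \<exists>x\<in>word_map w \<sigma> n ` X. \<exists>y\<in>word_map w \<sigma> n ` X. e \<le> dist x y" for N
    by (meson not_le)
  define W where "W n = {\<sigma>\<in>\<Omega>. \<exists>x\<in>word_map w \<sigma> n ` X. \<exists>y\<in>word_map w \<sigma> n ` X. e \<le> dist x y}" for n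
  have antimono: "W n \<subseteq> W m" if "m \<le> n" for m n
    using cylinder_antimono[OF _ that] unfolding W_def by blast
  have nonempty: "W n \<noteq> {}" for n
    using wide[of n] antimono[of n] unfolding W_def by blast
  have "compact (W n)" for n
  proof -
    let ?d = "\<lambda>(\<sigma>, x, y). dist (word_map w \<sigma> n x) (word_map w \<sigma> n y)"
    let ?C = "\<Omega> \<times> X \<times> X"
    have "continuous_on ?C (\<lambda>p. (\<lambda>(\<sigma>, x). word_map w \<sigma> n x) (fst p, fst (snd p)))"
      by (rule continuous_on_compose2[OF continuous_word_map])
        (auto intro!: continuous_on_Pair continuous_on_fst continuous_on_snd continuous_on_id)
    moreover have "continuous_on ?C (\<lambda>p. (\<lambda>(\<sigma>, x). word_map w \<sigma> n x) (fst p, snd (snd p)))"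
      by (rule continuous_on_compose2[OF continuous_word_map])
        (auto intro!: continuous_on_Pair continuous_on_fst continuous_on_snd continuous_on_id)
    ultimately have cont: "continuous_on ?C ?d"
      by (auto intro!: continuous_intros simp: case_prod_unfold)
    have compact_C: "compact ?C"
      by (intro compact_Times compact_words compact_X)
    have "closed (?C \<inter> ?d -` {e..})"
      by (rule continuous_closed_preimage[OF cont compact_imp_closed[OF compact_C]]) simp
    then have "compact (?C \<inter> (?C \<inter> ?d -` {e..}))"
      by (rule compact_Int_closed[OF compact_C])
    then have "compact (fst ` (?C \<inter> (?C \<inter> ?d -` {e..})))"
      by (rule compact_continuous_image[rotated]) (intro continuous_intros)
    also have "fst ` (?C \<inter> (?C \<inter> ?d -` {e..})) = W n"
      unfolding W_def by (force simp: image_iff)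
    finally show ?thesis .
  qed
  then have "\<Inter> (range W) \<noteq> {}"
    using compact_nested_Inter_nonempty[of W] nonempty antimono by blast
  then obtain \<sigma> where \<sigma>: "\<And>n. \<sigma> \<in> W n" by blast
  then have "\<sigma> \<in> \<Omega>" unfolding W_def by blast
  have "e \<le> diameter (word_map w \<sigma> n ` X)" for n
    using \<sigma>[of n] dist_le_diameter_cylinder[OF \<open>\<sigma> \<in> \<Omega>\<close>, of _ n] unfolding W_def
    by (blast intro: order_trans)
  moreover have "(\<lambda>n. diameter (word_map w \<sigma> n ` X)) \<longlonglongrightarrow> 0"
    using weakly_hyperbolic \<open>\<sigma> \<in> \<Omega>\<close> by (simp add: weakly_hyperbolic_def)
  ultimately have "e \<le> 0"
    by (intro LIMSEQ_le_const) auto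
  with assms show False by simp
qed

section \<open>Fixed points of finite compositions\<close>

text \<open>A fixed point of \<open>f = word_map w \<sigma> n\<close> is a value of every iterate \<open>f\<^sup>m\<close>, and the range of
  \<open>f\<^sup>m\<close> is the cylinder of level \<open>m * n \<ge> m\<close> along the periodic word.\<close>

lemma fixed_point_in_cylinders:
  assumes "\<sigma> \<in> \<Omega>" "n \<ge> 1" "x \<in> X" "word_map w \<sigma> n x = x"
  shows "x \<in> word_map w (loop \<sigma> n) m ` X"
proof -
  have "(word_map w \<sigma> n ^^ m) x = x"
    using assms(4) by (induction m) auto
  then have "x \<in> word_map w (loop \<sigma> n) (m * n) ` X"
    using assms(3) by (metis word_map_loop_power imageI)
  moreover have "m \<le> m * n" using assms(2) by simp
  ultimately show ?thesis
    using cylinder_antimono[OF loop_in_infinite_words[OF assms(1)]] by blast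
qed

text \<open>The maps need not contract distances, so Banach's theorem does not apply. Instead, the
  intersection of the cylinders along the periodic word is mapped into itself and has one point.\<close>

lemma ex1_fixed_point:
  assumes \<sigma>: "\<sigma> \<in> \<Omega>" and n: "n \<ge> 1"
  shows "\<exists>!x. x \<in> X \<and> word_map w \<sigma> n x = x"
proof -
  define \<tau> where "\<tau> = loop \<sigma> n"
  define f where "f = word_map w \<sigma> n"
  have \<tau>: "\<tau> \<in> \<Omega>"
    using loop_in_infinite_words[OF \<sigma>] by (simp add: \<tau>_def)
  have power: "word_map w \<tau> (k * n) = f ^^ k" for k
    by (simp add: \<tau>_def f_def word_map_loop_power)
  have "\<Inter> (range (\<lambda>m. word_map w \<tau> m ` X)) \<noteq> {}"
    by (rule compact_nested_Inter_nonempty) (use X_nonempty compact_cylinder cylinder_antimono \<tau> in auto)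
  then obtain x where x: "\<And>m. x \<in> word_map w \<tau> m ` X" by blast
  have "x \<in> X" using x[of 0] by simp
  have "f x \<in> word_map w \<tau> m ` X" for m
  proof -
    obtain z where z: "z \<in> X" "x = word_map w \<tau> (m * n) z" using x by blast
    then have "f x = word_map w \<tau> (Suc m * n) z"
      unfolding power by simp
    moreover have "m \<le> Suc m * n" using n by (cases n) auto
    ultimately show ?thesis using cylinder_antimono[OF \<tau>] z(1) by blast
  qed
  then have "f x = x"
    using eq_if_in_all_cylinders[OF \<tau>] x by blast
  moreover have "y = x" if "y \<in> X" "f y = y" for y
    using eq_if_in_all_cylinders[OF \<tau> _ x] fixed_point_in_cylinders[OF \<sigma> n that(1)] that(2)
    by (simp add: \<tau>_def f_def)
  ultimately show ?thesis
    using \<open>x \<in> X\<close> unfolding f_def by blast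
qed

definition fixed_points :: "'a set" where
  "fixed_points = {x \<in> X. \<exists>\<sigma>\<in>\<Omega>. \<exists>n\<ge>1. word_map w \<sigma> n x = x}"

lemma fixed_point_in_cylinder:
  assumes "\<sigma> \<in> \<Omega>" "n \<ge> 1"
  obtains p where "p \<in> fixed_points" "p \<in> word_map w \<sigma> n ` X"
proof -
  obtain p where p: "p \<in> X" "word_map w \<sigma> n p = p" using ex1_fixed_point[OF assms] by blast
  then have "p \<in> fixed_points" using assms unfolding fixed_points_def by blast
  moreover have "p \<in> word_map w \<sigma> n ` X" using p by (metis imageI)
  ultimately show thesis by (rule that)
qed

lemma fixed_pointE:
  assumes "p \<in> fixed_points"
  obtains \<tau> where "\<tau> \<in> \<Omega>" "\<And>m. p \<in> word_map w \<tau> m ` X"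
  using assms fixed_point_in_cylinders loop_in_infinite_words unfolding fixed_points_def by blast

lemma closure_fixed_points_in: "closure fixed_points \<in> nonempty_compacts X"
proof -
  have sub: "closure fixed_points \<subseteq> X"
    by (rule closure_minimal) (auto simp: fixed_points_def compact_imp_closed compact_X)
  then have "compact (X \<inter> closure fixed_points)"
    by (intro compact_Int_closed compact_X closed_closure)
  moreover have "X \<inter> closure fixed_points = closure fixed_points" using sub by blast
  moreover obtain l where "l \<in> \<Lambda>" using \<Lambda>_nonempty by blast
  then have "(\<lambda>_. l) \<in> \<Omega>" by (simp add: infinite_words_def)
  then have "fixed_points \<noteq> {}" using fixed_point_in_cylinder[of "\<lambda>_. l" 1] by auto
  ultimately show ?thesis
    using sub by (auto simp: nonempty_compacts_def)
qed

text \<open>Each cylinder around \<open>x\<close> contains the fixed point of its own composition, and the cylinders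
  shrink.\<close>

lemma in_closure_if_in_all_cylinders:
  assumes "\<sigma> \<in> \<Omega>" and "\<And>m. x \<in> word_map w \<sigma> m ` X"
  shows "x \<in> closure fixed_points"
  unfolding closure_approachable
proof (intro allI impI)
  fix e :: real
  assume "e > 0"
  then obtain N where N: "\<And>n \<sigma> x y. \<lbrakk>n \<ge> N; \<sigma> \<in> \<Omega>; x \<in> word_map w \<sigma> n ` X;
      y \<in> word_map w \<sigma> n ` X\<rbrakk> \<Longrightarrow> dist x y < e"
    using uniformly_small_cylinders by metis
  \<comment> \<open>At level \<open>0\<close> the composition is the identity, hence \<open>Suc N\<close>.\<close>
  obtain p where p: "p \<in> fixed_points" "p \<in> word_map w \<sigma> (Suc N) ` X"
    using fixed_point_in_cylinder[OF assms(1) le_add1[of 1 N]] by (metis plus_1_eq_Suc)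
  have "dist p x < e"
    by (rule N[OF le_SucI[OF order_refl] assms(1) p(2) assms(2)])
  with p(1) show "\<exists>p\<in>fixed_points. dist p x < e" by blast
qed

section \<open>Invariance and attraction\<close>

text \<open>Forward inclusion: the image of a fixed point under \<open>w\<^sub>l\<close> lies in all cylinders along the word
  with \<open>l\<close> prepended, and continuity extends this to the closure. Backward inclusion: by rotation,
  every fixed point is the image of a fixed point, and the image of the closure is closed.\<close>

lemma hutchinson_closure_fixed_points:
  "hutchinson \<Lambda> w (closure fixed_points) = closure fixed_points"
proof
  have "w (l, p) \<in> closure fixed_points" if l: "l \<in> \<Lambda>" and p: "p \<in> fixed_points" for l p
  proof -
    obtain \<tau> where \<tau>: "\<tau> \<in> \<Omega>" "\<And>m. p \<in> word_map w \<tau> m ` X"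
      using fixed_pointE[OF p] by blast
    define \<sigma> where "\<sigma> = case_nat l \<tau>"
    have \<sigma>: "\<sigma> \<in> \<Omega>"
      using l \<tau>(1) by (auto simp: \<sigma>_def infinite_words_def split: nat.split)
    have "w (l, p) \<in> word_map w \<sigma> m ` X" for m
    proof -
      obtain z where "z \<in> X" "p = word_map w \<tau> m z" using \<tau>(2) by blast
      then have "w (l, p) = word_map w \<sigma> (Suc m) z"
        unfolding word_map_Suc_left by (simp add: \<sigma>_def)
      with \<open>z \<in> X\<close> have "w (l, p) \<in> word_map w \<sigma> (Suc m) ` X" by (metis imageI)
      then show ?thesis
        by (rule subsetD[OF cylinder_antimono[OF \<sigma> le_SucI[OF order_refl]]])
    qed
    then show ?thesis by (rule in_closure_if_in_all_cylinders[OF \<sigma>])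
  qed
  moreover have "continuous_on (closure fixed_points) (\<lambda>x. w (l, x))" if "l \<in> \<Lambda>" for l
    by (rule continuous_on_compose2[OF continuous_w])
      (use that closure_fixed_points_in in \<open>auto intro!: continuous_intros simp: nonempty_compacts_def\<close>)
  ultimately have "(\<lambda>x. w (l, x)) ` closure fixed_points \<subseteq> closure fixed_points" if "l \<in> \<Lambda>" for l
    using that by (intro image_closure_subset) auto
  then show "hutchinson \<Lambda> w (closure fixed_points) \<subseteq> closure fixed_points"
    unfolding hutchinson_def by blast
next
  have "closed (hutchinson \<Lambda> w (closure fixed_points))"
    using hutchinson_in_nonempty_compacts[OF ifs \<Lambda>_nonempty closure_fixed_points_in]
    by (simp add: nonempty_compacts_def compact_imp_closed)
  moreover have "p \<in> hutchinson \<Lambda> w (closure fixed_points)" if p: "p \<in> fixed_points" for p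
  proof -
    obtain \<sigma> n where \<sigma>: "p \<in> X" "\<sigma> \<in> \<Omega>" "n \<ge> 1" "word_map w \<sigma> n p = p"
      using p unfolding fixed_points_def by blast
    let ?\<tau> = "\<lambda>i. loop \<sigma> n (Suc i)"
    have \<tau>: "?\<tau> \<in> \<Omega>" using \<sigma>(2) by (simp add: loop_def infinite_words_def)
    obtain q where q: "w (\<sigma> 0, q) = p" "word_map w ?\<tau> n q = q" "q = word_map w ?\<tau> (n - 1) p"
      using fixed_point_rotate[OF \<sigma>(4,3)] by blast
    have "q \<in> X" using q(3) word_map_in[OF \<tau> \<sigma>(1)] by simp
    then have "q \<in> fixed_points" using q(2) \<tau> \<sigma>(3) unfolding fixed_points_def by blast
    then have "q \<in> closure fixed_points" using closure_subset by blast
    moreover have "\<sigma> 0 \<in> \<Lambda>" using \<sigma>(2) by (simp add: infinite_words_def)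
    ultimately show ?thesis
      using q(1) unfolding hutchinson_def by blast
  qed
  ultimately show "closure fixed_points \<subseteq> hutchinson \<Lambda> w (closure fixed_points)"
    by (intro closure_minimal) auto
qed

text \<open>The form in which iterates are compared with cylinders: the \<open>n\<close>-th iterate of \<open>B\<close> meets every
  cylinder of level \<open>n\<close>, and for \<open>B \<subseteq> X\<close> it is covered by them.\<close>

lemma hutchinson_power:
  "(hutchinson \<Lambda> w ^^ n) B = {word_map w \<sigma> n x |\<sigma> x. \<sigma> \<in> \<Omega> \<and> x \<in> B}"
proof (induction n)
  case 0
  have "\<Omega> \<noteq> {}" using \<Lambda>_nonempty by (auto simp: infinite_words_def)
  then show ?case by auto
next
  case (Suc n)
  have "hutchinson \<Lambda> w {word_map w \<sigma> n x |\<sigma> x. \<sigma> \<in> \<Omega> \<and> x \<in> B} =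
    {word_map w \<sigma> (Suc n) x |\<sigma> x. \<sigma> \<in> \<Omega> \<and> x \<in> B}" (is "?L = ?R")
  proof
    show "?L \<subseteq> ?R"
    proof
      fix y assume "y \<in> ?L"
      then obtain l \<sigma> x where y: "l \<in> \<Lambda>" "\<sigma> \<in> \<Omega>" "x \<in> B" "y = w (l, word_map w \<sigma> n x)"
        unfolding hutchinson_def by blast
      have "case_nat l \<sigma> \<in> \<Omega>"
        using y by (auto simp: infinite_words_def split: nat.split)
      moreover have "y = word_map w (case_nat l \<sigma>) (Suc n) x"
        unfolding word_map_Suc_left y by simp
      ultimately show "y \<in> ?R" using y(3) by blast
    qed
    show "?R \<subseteq> ?L"
    proof
      fix y assume "y \<in> ?R"
      then obtain \<sigma> x where y: "\<sigma> \<in> \<Omega>" "x \<in> B" "y = word_map w \<sigma> (Suc n) x" by blast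
      have "(\<lambda>i. \<sigma> (Suc i)) \<in> \<Omega>" "\<sigma> 0 \<in> \<Lambda>"
        using y by (auto simp: infinite_words_def)
      then show "y \<in> ?L"
        unfolding hutchinson_def y(3) word_map_Suc_left using y(2) by blast
    qed
  qed
  then show ?case using Suc by simp
qed

text \<open>Each point of the \<open>n\<close>-th iterate shares a cylinder of level \<open>n\<close> with a fixed point, and each
  fixed point shares one with a point of the iterate. The level at which cylinders are small does
  not depend on \<open>B\<close>.\<close>

lemma global_attractor_closure_fixed_points:
  "global_attractor \<Lambda> X w (closure fixed_points)"
  unfolding global_attractor_def
proof (intro conjI ballI closure_fixed_points_in)
  fix B assume "B \<in> nonempty_compacts X"
  then obtain b where B: "B \<subseteq> X" and b: "b \<in> B"
    unfolding nonempty_compacts_def by blast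
  let ?K = "closure fixed_points"
  let ?F = "\<lambda>n. (hutchinson \<Lambda> w ^^ n) B"
  show "(\<lambda>n. hausdorff_dist (?F n) ?K) \<longlonglongrightarrow> 0"
  proof (rule LIMSEQ_I)
    fix r :: real assume "r > 0"
    then have "r / 2 > 0" by simp
    then obtain N where N: "\<And>n \<sigma> x y. \<lbrakk>n \<ge> N; \<sigma> \<in> \<Omega>; x \<in> word_map w \<sigma> n ` X;
        y \<in> word_map w \<sigma> n ` X\<rbrakk> \<Longrightarrow> dist x y < r / 2"
      using uniformly_small_cylinders by metis
    have "norm (hausdorff_dist (?F n) ?K - 0) < r" if n: "n \<ge> Suc N" for n
    proof -
      \<comment> \<open>The fixed point of the composition that produced \<open>a\<close> is close to \<open>a\<close>.\<close>
      have fwd: "infdist a ?K \<le> r / 2" if a_in: "a \<in> ?F n" for a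
      proof -
        obtain \<sigma> x where a: "\<sigma> \<in> \<Omega>" "x \<in> B" "a = word_map w \<sigma> n x"
          using a_in unfolding hutchinson_power by blast
        have "n \<ge> 1" using n by simp
        then obtain p where p: "p \<in> fixed_points" "p \<in> word_map w \<sigma> n ` X"
          using fixed_point_in_cylinder[OF a(1)] by blast
        have "dist a p < r / 2" using N[of n \<sigma> a p] a p n B by auto
        moreover have "p \<in> ?K" using p(1) closure_subset by blast
        ultimately show ?thesis by (intro infdist_le2[of p]) auto
      qed
      \<comment> \<open>A fixed point lies in a cylinder of level \<open>n\<close>, and so does the image of \<open>b\<close> along the same
        word. The bound passes to the closure because the sublevel set is closed.\<close>
      have "fixed_points \<subseteq> {x. infdist x (?F n) \<le> r / 2}"
      proof
        fix p assume "p \<in> fixed_points"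
        then obtain \<tau> where \<tau>: "\<tau> \<in> \<Omega>" "\<And>m. p \<in> word_map w \<tau> m ` X"
          using fixed_pointE by blast
        have "dist p (word_map w \<tau> n b) < r / 2"
          using N[of n \<tau> p "word_map w \<tau> n b"] \<tau> n b B by auto
        moreover have "word_map w \<tau> n b \<in> ?F n"
          unfolding hutchinson_power using \<tau>(1) b by blast
        ultimately have "infdist p (?F n) \<le> r / 2"
          by (intro infdist_le2[of "word_map w \<tau> n b"] less_imp_le)
        then show "p \<in> {x. infdist x (?F n) \<le> r / 2}" by simp
      qed
      moreover have "closed {x. infdist x (?F n) \<le> r / 2}"
        by (rule closed_Collect_le[OF continuous_on_infdist[OF continuous_on_id] continuous_on_const])
      ultimately have "?K \<subseteq> {x. infdist x (?F n) \<le> r / 2}"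
        by (rule closure_minimal)
      then have bwd: "infdist q (?F n) \<le> r / 2" if "q \<in> ?K" for q
        using that by blast
      have "\<Omega> \<noteq> {}" using \<Lambda>_nonempty by (auto simp: infinite_words_def)
      then have "?F n \<noteq> {}"
        unfolding hutchinson_power using b by blast
      then have "hausdorff_dist (?F n) ?K \<le> r / 2" and "0 \<le> hausdorff_dist (?F n) ?K"
        using hausdorff_dist_le[OF _ fwd bwd] hausdorff_dist_nonneg[OF _ fwd bwd] by blast+
      then show ?thesis
        using \<open>r > 0\<close> by simp
    qed
    then show "\<exists>no. \<forall>n\<ge>no. norm (hausdorff_dist (?F n) ?K - 0) < r" by blast
  qed
qed

end

theorem theorem1:
  fixes \<Lambda> :: "'l::metric_space set" and X :: "'a::metric_space set" and w :: "'l \<times> 'a \<Rightarrow> 'a"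
  assumes "compact X" and "X \<noteq> {}"
    and "compact \<Lambda>" and "\<Lambda> \<noteq> {}"
    and "iterated_function_system \<Lambda> X w"
    and "weakly_hyperbolic \<Lambda> X w"
  shows "\<exists>K \<in> nonempty_compacts X.
           global_attractor \<Lambda> X w K \<and>
           hutchinson \<Lambda> w K = K \<and>
           (\<forall>\<sigma>\<in>infinite_words \<Lambda>. \<forall>n\<ge>1. \<exists>!x. x \<in> X \<and> word_map w \<sigma> n x = x) \<and>
           K = closure {x \<in> X. \<exists>\<sigma>\<in>infinite_words \<Lambda>. \<exists>n\<ge>1. word_map w \<sigma> n x = x}"
proof -
  have locale_holds: "compact_weakly_hyperbolic_ifs \<Lambda> X w"
    by (rule compact_weakly_hyperbolic_ifs.intro[OF assms])
  note K = compact_weakly_hyperbolic_ifs.closure_fixed_points_in[OF locale_holds]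
    and attractor = compact_weakly_hyperbolic_ifs.global_attractor_closure_fixed_points[OF locale_holds]
    and invariant = compact_weakly_hyperbolic_ifs.hutchinson_closure_fixed_points[OF locale_holds]
    and unique = compact_weakly_hyperbolic_ifs.ex1_fixed_point[OF locale_holds]
    and P = compact_weakly_hyperbolic_ifs.fixed_points_def[OF locale_holds]
  show ?thesis
    by (intro bexI[OF _ K] conjI ballI allI impI attractor invariant unique) (simp_all only: P)
qed

end
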